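(* Let $G=(V,E)$ be a finite, simple, undirected, connected graph with at least two vertices, and let $X \subseteq V$ with $|X| = d \geq 3$ be such that $G[V\setminus X]$ is a disjoint union of cliques. If $X$ is not an independent set in $G$, then $\chi_{ON}(G) \leq d+1$.
   Context: A CFON coloring of a graph $G=(V,E)$ with $k$ colors is a map $C: V \to \{1,\dots,k\}$ such that for every $v \in V$ there is a color $i$ with $|N(v)\cap C^{-1}(i)| = 1$, where $N(v)$ is the open neighborhood of $v$. $\chi_{ON}(G)$ is the minimum $k$ for which a CFON coloring with $k$ colors exists. *)

theory Defs
  imports
    "Graph_Theory.Graph_Theory"
    "HOL-Library.FuncSet"
    "HOL-Library.Disjoint_Sets"
    "HOL-Library.Extended_Nat"
begin

text \<open>A finite simple undirected graph is a \<^locale>\<open>graph\<close> of the library: a finite digraph without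
  loops and parallel arcs whose arc relation is symmetric. Adjacency of \<open>u\<close> and \<open>v\<close> is
  \<open>u \<rightarrow>\<^bsub>G\<^esub> v\<close>.\<close>

definition open_nbhd :: "('a, 'b) pre_digraph \<Rightarrow> 'a \<Rightarrow> 'a set" where
  "open_nbhd G v = {u \<in> verts G. v \<rightarrow>\<^bsub>G\<^esub> u}"

definition independent_set :: "('a, 'b) pre_digraph \<Rightarrow> 'a set \<Rightarrow> bool" where
  "independent_set G S \<longleftrightarrow> S \<subseteq> verts G \<and> (\<forall>u\<in>S. \<forall>v\<in>S. \<not> u \<rightarrow>\<^bsub>G\<^esub> v)"

text \<open>The parts of \<open>P\<close> are the vertex sets of the cliques; the family \<open>P\<close> may be empty.\<close>

definition disjoint_union_of_cliques :: "('a, 'b) pre_digraph \<Rightarrow> bool" where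
  "disjoint_union_of_cliques H \<longleftrightarrow>
     (\<exists>P. partition_on (verts H) P \<and>
          (\<forall>u\<in>verts H. \<forall>v\<in>verts H. u \<rightarrow>\<^bsub>H\<^esub> v \<longleftrightarrow> u \<noteq> v \<and> (\<exists>K\<in>P. u \<in> K \<and> v \<in> K)))"

definition cfon_coloring :: "('a, 'b) pre_digraph \<Rightarrow> nat \<Rightarrow> ('a \<Rightarrow> nat) \<Rightarrow> bool" where
  "cfon_coloring G k C \<longleftrightarrow>
     C \<in> verts G \<rightarrow> {1..k} \<and>
     (\<forall>v\<in>verts G. \<exists>i\<in>{1..k}. card (open_nbhd G v \<inter> C -` {i}) = 1)"

text \<open>The value is \<open>\<infinity>\<close> iff there is no CFON coloring at all (for instance, if some vertex is
  isolated), so a finite upper bound includes the existence of a coloring. Otherwise the infimum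
  is a minimum.\<close>

definition chi_ON :: "('a, 'b) pre_digraph \<Rightarrow> enat" where
  "chi_ON G = (INF k \<in> {k. \<exists>C. cfon_coloring G k C}. enat k)"

end

theory Submission
  imports Defs
begin

text \<open>Colour \<open>X\<close> with at most \<open>d\<close> colours so that every vertex of \<open>X\<close> with a neighbour in \<open>X\<close> sees a
  unique colour inside \<open>X\<close>. This takes care of all of \<open>X\<close> but the set \<open>B\<close> of vertices isolated
  in \<open>G[X]\<close>, whose colours can thus be spent outside \<open>X\<close>. Two further colours \<open>z\<close> and \<open>e\<close> are
  the default ones outside \<open>X\<close>: if exactly one vertex \<open>v0\<close> of a clique gets \<open>z\<close>, then all others
  see a unique \<open>z\<close>. Each \<open>b \<in> B\<close> is assigned to an adjacent clique; if \<open>T\<close> is the set of those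
  assigned to \<open>K\<close>, then a set \<open>S \<subseteq> K\<close> dominating \<open>T\<close> gets distinct colours of \<open>T\<close>, and \<open>v0\<close> is
  fine unless the colours on \<open>S\<close> are exactly those which \<open>v0\<close> sees uniquely in \<open>X\<close>.

  There are only \<open>d + 1\<close> colours, so \<open>e\<close> must be saved in \<open>X\<close>. If some non-isolated \<open>y \<in> X\<close> is
  not the only \<open>X\<close>-neighbour of another vertex of \<open>X\<close>, then \<open>e\<close> is the colour of \<open>y\<close>. Otherwise
  \<open>G[X]\<close> is a matching plus isolated vertices, and the ends of a matching edge
  \<open>{x1, x2}\<close> can share one colour, unless there is a vertex \<open>v\<close> whose neighbours are just
  \<open>x1\<close> and \<open>x2\<close>; in this last case \<open>e\<close> is the colour of \<open>x1\<close>, and if \<open>x2\<close> then lacks a uniquely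
  coloured neighbour, recolouring \<open>v\<close> provides one.\<close>

text \<open>The CFON condition at one vertex, for colours of any type: the final colours are
  \<open>None\<close> and \<open>Some x\<close> for \<open>x\<close> in \<open>X\<close>.\<close>

definition happy :: "('a \<Rightarrow> 'a \<Rightarrow> bool) \<Rightarrow> ('a \<Rightarrow> 'c) \<Rightarrow> 'a \<Rightarrow> bool" where
  "happy E F v \<longleftrightarrow> (\<exists>u. E v u \<and> (\<forall>u'. E v u' \<longrightarrow> F u' = F u \<longrightarrow> u' = u))"

lemma happy_cong:
  assumes "happy E F v" "\<And>u. E v u \<Longrightarrow> F' u = F u"
  shows "happy E F' v"
  using assms unfolding happy_def by metis

section \<open>Graphs that induce disjoint cliques outside \<open>X\<close>\<close>

locale cluster_modulator =
  fixes V X :: "'a set" and E :: "'a \<Rightarrow> 'a \<Rightarrow> bool"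
  assumes X_subset: "X \<subseteq> V"
    and E_sym: "E u v \<Longrightarrow> E v u"
    and E_irrefl: "\<not> E v v"
    and adj_in: "E u v \<Longrightarrow> v \<in> V"
    and E_trans: "\<lbrakk>u \<in> V - X; v \<in> V - X; w \<in> V - X; E u v; E v w; u \<noteq> w\<rbrakk> \<Longrightarrow> E u w"
begin

definition clique_of :: "'a \<Rightarrow> 'a set" where
  "clique_of v = insert v {u \<in> V - X. E v u}"

definition cliques :: "'a set set" where
  "cliques = clique_of ` (V - X)"

lemma clique_of_in [simp]: "v \<in> V - X \<Longrightarrow> clique_of v \<in> cliques"
  by (auto simp: cliques_def)

lemma in_clique_of [simp]: "v \<in> clique_of v"
  by (auto simp: clique_of_def)

lemma clique_outside: "\<lbrakk>K \<in> cliques; v \<in> K\<rbrakk> \<Longrightarrow> v \<in> V - X"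
  by (auto simp: cliques_def clique_of_def)

lemma clique_ne: "K \<in> cliques \<Longrightarrow> K \<noteq> {}"
  by (auto simp: cliques_def clique_of_def)

text \<open>By \<open>E_trans\<close>, adjacent vertices outside \<open>X\<close> have the same
  closed neighbourhood there, so these neighbourhoods are the cliques.\<close>

lemma clique_of_eq:
  assumes "K \<in> cliques" "v \<in> K"
  shows "clique_of v = K"
proof -
  obtain w where w: "w \<in> V - X" "K = clique_of w" using assms by (auto simp: cliques_def)
  have v: "v \<in> V - X" using clique_outside assms by blast
  show ?thesis
  proof (cases "v = w")
    case False
    then have vw: "E w v" "E v w" using w assms(2) E_sym by (auto simp: clique_of_def)
    have "E v u \<longleftrightarrow> E w u" if "u \<in> V - X" "u \<noteq> v" "u \<noteq> w" for u
      using that vw v w(1) E_trans[of v w u] E_trans[of w v u] by blast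
    then show ?thesis using vw v w E_irrefl by (auto simp: clique_of_def)
  qed (simp add: w)
qed

lemma clique_adj_iff:
  assumes "K \<in> cliques" "v \<in> K"
  shows "E v u \<longleftrightarrow> u \<in> K \<and> u \<noteq> v \<or> u \<in> X \<and> E v u"
  using clique_of_eq[OF assms] clique_outside[OF assms(1)] assms(2) E_irrefl adj_in
  by (auto simp: clique_of_def)

end

section \<open>Colouring a single clique when \<open>X\<close> is already coloured\<close>

text \<open>The colours \<open>z\<close> and \<open>e\<close> are used freely outside \<open>X\<close>, and \<open>z\<close> does not occur in \<open>X\<close>.
  The colour \<open>c b\<close> of \<open>b \<in> B\<close> is private_unique: it occurs once in \<open>X\<close>, and will serve a clique
  chosen to provide for \<open>b\<close>. Vertices of \<open>W\<close> are exempt from having a uniquely coloured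
  neighbour, and \<open>D\<close> contains the \<open>X\<close>-neighbours of vertices which see in \<open>X\<close> no unique colour
  except possibly \<open>e\<close>.\<close>

locale modulator_colouring = cluster_modulator V X E
  for V X :: "'a set" and E +
  fixes B D W :: "'a set" and c :: "'a \<Rightarrow> 'c" and z e p :: 'c and wit :: "'a \<Rightarrow> 'a"
  assumes B_subset: "B \<subseteq> X"
    and z_fresh: "x \<in> X \<Longrightarrow> c x \<noteq> z"
    and distinct: "e \<noteq> z" "p \<noteq> z" "p \<noteq> e"
    and private_ne: "b \<in> B \<Longrightarrow> c b \<noteq> e"
    and private_unique: "\<lbrakk>b \<in> B; x \<in> X; c x = c b\<rbrakk> \<Longrightarrow> x = b"
    and B_isolated: "\<lbrakk>b \<in> B; x \<in> X\<rbrakk> \<Longrightarrow> \<not> E b x"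
    and B_nbr: "b \<in> B \<Longrightarrow> \<exists>v. E b v"
    and wit: "x \<in> X - B - W \<Longrightarrow> wit x \<in> X - B \<and> E x (wit x) \<and> c (wit x) \<noteq> e"
    and wit_unique: "\<lbrakk>x \<in> X - B - W; x' \<in> X; E x x'; c x' = c (wit x)\<rbrakk> \<Longrightarrow> x' = wit x"
    and wit_D: "x \<in> (X - B - W) \<inter> D \<Longrightarrow> c (wit x) \<noteq> p"
    and D_p: "x \<in> D \<Longrightarrow> c x \<noteq> p"
    and not_D: "\<lbrakk>v \<in> V - X; x \<in> X - D; E v x\<rbrakk> \<Longrightarrow>
      \<exists>x\<in>X. E v x \<and> c x \<noteq> e \<and> (\<forall>x'\<in>X. E v x' \<longrightarrow> c x' = c x \<longrightarrow> x' = x)"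
    and singleton: "\<lbrakk>v \<in> V - X; \<And>u. E v u \<Longrightarrow> u \<in> X\<rbrakk> \<Longrightarrow>
      \<exists>x\<in>X. E v x \<and> (\<forall>x'\<in>X. E v x' \<longrightarrow> c x' = c x \<longrightarrow> x' = x)"
begin

text \<open>The colour \<open>e\<close> is excluded because cliques use it freely, which could
  destroy its uniqueness.\<close>

definition seen :: "'a \<Rightarrow> 'c set" where
  "seen v = {q. q \<noteq> e \<and> (\<exists>x\<in>X. E v x \<and> c x = q \<and> (\<forall>x'\<in>X. E v x' \<longrightarrow> c x' = q \<longrightarrow> x' = x))}"

definition extend :: "('a \<Rightarrow> 'c) \<Rightarrow> 'a \<Rightarrow> 'c" where
  "extend g u = (if u \<in> X then c u else g u)"

text \<open>\<open>T\<close> is the set of vertices of \<open>B\<close> that \<open>K\<close> must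
  provide for. Each of their colours occurs at most once on \<open>K\<close>, so a vertex of such a
  colour next to \<open>t\<close> can become the uniquely coloured neighbour of
  \<open>t\<close>.\<close>

definition serves :: "'a set \<Rightarrow> 'a set \<Rightarrow> ('a \<Rightarrow> 'c) \<Rightarrow> bool" where
  "serves K T g \<longleftrightarrow>
     (\<forall>v\<in>K. happy E (extend g) v) \<and> g ` K \<subseteq> {z, e} \<union> c ` T \<and>
     (\<forall>u\<in>K. \<forall>v\<in>K. g u = g v \<longrightarrow> g u \<in> c ` T \<longrightarrow> u = v) \<and>
     (\<forall>t\<in>T. \<exists>v\<in>K. E t v \<and> g v \<in> c ` T)"

lemma private_seen:
  assumes "b \<in> B"
  shows "c b \<in> seen v \<longleftrightarrow> E v b"
proof -
  have "b \<in> X" "c b \<noteq> e" using assms B_subset private_ne by auto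
  moreover have "x = b" if "x \<in> X" "c x = c b" for x
    using private_unique[OF assms that] .
  ultimately show ?thesis unfolding seen_def by blast
qed

lemma z_not_seen: "z \<notin> seen v"
  using z_fresh by (auto simp: seen_def)

lemma e_not_seen: "e \<notin> seen v"
  by (auto simp: seen_def)

lemma inj_B: "inj_on c B"
  using B_subset private_unique by (auto simp: inj_on_def)

lemma happy_if_seen:
  assumes "K \<in> cliques" "v \<in> K" "q \<in> seen v" "\<And>u. \<lbrakk>u \<in> K; u \<noteq> v\<rbrakk> \<Longrightarrow> g u \<noteq> q"
  shows "happy E (extend g) v"
proof -
  obtain x where x: "x \<in> X" "E v x" "c x = q" "\<forall>x'\<in>X. E v x' \<longrightarrow> c x' = q \<longrightarrow> x' = x"
    using assms(3) unfolding seen_def by blast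
  have "u' = x" if u': "E v u'" "extend g u' = extend g x" for u'
  proof (cases "u' \<in> X")
    case True
    then have "c u' = q" using u'(2) x(1,3) by (simp add: extend_def)
    then show ?thesis using x(4) True u'(1) by blast
  next
    case False
    then have "u' \<in> K" "u' \<noteq> v" using clique_adj_iff[OF assms(1,2)] u'(1) by blast+
    then have "g u' \<noteq> q" by (rule assms(4))
    then show ?thesis using False u'(2) x(1,3) by (simp add: extend_def)
  qed
  then show ?thesis using x(2) unfolding happy_def by blast
qed

lemma happy_if_clique:
  assumes "K \<in> cliques" "v \<in> K" "u \<in> K" "u \<noteq> v"
    and "\<And>u'. \<lbrakk>u' \<in> K; u' \<noteq> v; g u' = g u\<rbrakk> \<Longrightarrow> u' = u"
    and "\<And>x. \<lbrakk>x \<in> X; E v x\<rbrakk> \<Longrightarrow> c x \<noteq> g u"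
  shows "happy E (extend g) v"
proof -
  have "u \<notin> X" using clique_outside assms(1,3) by blast
  have "u' = u" if u': "E v u'" "extend g u' = extend g u" for u'
  proof (cases "u' \<in> X")
    case True
    then show ?thesis using assms(6)[OF True u'(1)] u'(2) \<open>u \<notin> X\<close> by (simp add: extend_def)
  next
    case False
    then have "u' \<in> K" "u' \<noteq> v" using clique_adj_iff[OF assms(1,2)] u'(1) by blast+
    then show ?thesis using assms(5) u'(2) False \<open>u \<notin> X\<close> by (simp add: extend_def)
  qed
  moreover have "E v u" using assms clique_adj_iff by blast
  ultimately show ?thesis by (auto simp: happy_def)
qed

text \<open>All of \<open>K\<close> but \<open>v0\<close> sees the unique \<open>z\<close> at
  \<open>v0\<close>. For \<open>v0\<close> itself, a seen colour missing on \<open>S\<close> stays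
  unique, and a private colour used on \<open>S\<close> but not seen is absent from the
  \<open>X\<close>-neighbours of \<open>v0\<close>, hence unique for it too.\<close>

lemma serves_if_spare:
  assumes K: "K \<in> cliques" and T: "T \<subseteq> B"
    and S: "S \<subseteq> K" "inj_on \<phi> S" "\<phi> ` S \<subseteq> T" "\<And>t. t \<in> T \<Longrightarrow> \<exists>s\<in>S. E t s"
    and v0: "v0 \<in> K - S" "c ` \<phi> ` S \<noteq> seen v0"
  shows "\<exists>g. serves K T g"
proof -
  define g where "g u = (if u \<in> S then c (\<phi> u) else if u = v0 then z else e)" for u
  have priv: "c t \<noteq> z" "c t \<noteq> e" if "t \<in> T" for t
    using that T B_subset z_fresh private_ne by auto
  have inj: "inj_on c T" using inj_B T inj_on_subset by blast
  have gS: "u \<in> S \<and> c (\<phi> u) = q" if "g u = q" "q \<in> c ` T" for u q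
    using that priv by (auto simp: g_def split: if_splits)
  have inj_g: "u = v" if "g u = g v" "g u \<in> c ` T" for u v
  proof -
    have "u \<in> S" "v \<in> S" "c (\<phi> u) = c (\<phi> v)" using gS that by metis+
    then show ?thesis using S(2,3) inj by (metis image_subset_iff inj_on_eq_iff)
  qed
  have z_iff: "g u = z \<longleftrightarrow> u = v0" for u
    using v0 S(3) priv distinct by (auto simp: g_def)
  have "happy E (extend g) v" if v: "v \<in> K" for v
  proof (cases "v = v0")
    case False
    have gv0: "g v0 = z" using z_iff by blast
    then show ?thesis
      using v0(1) z_iff z_fresh False by (intro happy_if_clique[OF K v, of v0]) (simp_all add: gv0)
  next
    case True
    consider q where "q \<in> seen v0" "q \<notin> c ` \<phi> ` S" | s where "s \<in> S" "c (\<phi> s) \<notin> seen v0"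
      using v0(2) by blast
    then show ?thesis
    proof cases
      case 1
      then have "g u \<noteq> q" for u using z_not_seen e_not_seen by (auto simp: g_def)
      then show ?thesis using 1 True by (intro happy_if_seen[OF K v, of q]) auto
    next
      case 2
      have t: "\<phi> s \<in> T" and gs: "g s = c (\<phi> s)" using 2 S(3) by (auto simp: g_def)
      then have "\<not> E v0 (\<phi> s)" using 2 private_seen T by blast
      then have "c x \<noteq> g s" if "E v x" "x \<in> X" for x
        using that True gs private_unique t T by (metis subsetD)
      moreover have "s \<in> K" "s \<noteq> v" using 2 S(1) v0 True by auto
      ultimately show ?thesis using inj_g gs t
        by (intro happy_if_clique[OF K v, of s]) auto
    qed
  qed
  moreover have "g ` K \<subseteq> {z, e} \<union> c ` T" using S(3) by (auto simp: g_def)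
  moreover have "\<exists>v\<in>K. E t v \<and> g v \<in> c ` T" if "t \<in> T" for t
  proof -
    obtain s where "s \<in> S" "E t s" using S(4) \<open>t \<in> T\<close> by blast
    moreover have "g s \<in> c ` T" using S(3) \<open>s \<in> S\<close> by (auto simp: g_def)
    ultimately show ?thesis using S(1) by blast
  qed
  ultimately show ?thesis using inj_g unfolding serves_def by blast
qed

text \<open>If the colours \<open>\<phi> ` S\<close> happen to be those seen by \<open>v0\<close> but some \<open>t \<in> T\<close> is not used
  by \<open>\<phi>\<close>, then switching one vertex of \<open>S\<close> to the colour of \<open>t\<close> repairs this.\<close>

lemma serves_if_dominating:
  assumes K: "K \<in> cliques" and T: "T \<subseteq> B"
    and S: "S \<subseteq> K" "inj_on \<phi> S" "\<phi> ` S \<subseteq> T" "\<And>t. t \<in> T \<Longrightarrow> \<exists>s\<in>S. E t s" "S \<noteq> {}"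
    and v0: "v0 \<in> K - S" "\<not> (\<phi> ` S = T \<and> seen v0 = c ` T)"
  shows "\<exists>g. serves K T g"
proof (cases "c ` \<phi> ` S = seen v0")
  case False
  then show ?thesis using serves_if_spare[OF K T S(1-4) v0(1)] by blast
next
  case True
  then obtain t where t: "t \<in> T" "t \<notin> \<phi> ` S" using v0(2) S(3) by blast
  obtain s where s: "s \<in> S" using S(5) by blast
  let ?\<phi> = "\<phi>(s := t)"
  have inj: "inj_on ?\<phi> S" using S(2) t(2) by (auto simp: inj_on_def)
  have sub: "?\<phi> ` S \<subseteq> T" using S(3) t(1) by auto
  have "t \<in> ?\<phi> ` S" using s by auto
  moreover have "inj_on c T" using inj_B T inj_on_subset by blast
  ultimately have "c ` ?\<phi> ` S \<noteq> c ` \<phi> ` S"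
    using inj_on_image_eq_iff[of c T] sub S(3) t(2) by metis
  then show ?thesis using serves_if_spare[OF K T S(1) inj sub S(4) v0(1)] True by simp
qed

lemma serves_exists:
  assumes K: "K \<in> cliques" and T: "T \<subseteq> B" "T \<noteq> {}" "\<And>t. t \<in> T \<Longrightarrow> \<exists>v\<in>K. E t v"
    and ne: "\<And>x. T = {x} \<Longrightarrow> \<exists>v\<in>K. seen v \<noteq> {c x}"
  shows "\<exists>g. serves K T g"
proof -
  obtain f where f: "\<And>t. t \<in> T \<Longrightarrow> f t \<in> K \<and> E t (f t)" using T(3) by metis
  define S where "S = f ` T"
  define \<phi> where "\<phi> = inv_into T f"
  have S: "S \<subseteq> K" "inj_on \<phi> S" "\<phi> ` S \<subseteq> T" "\<And>t. t \<in> T \<Longrightarrow> \<exists>s\<in>S. E t s" "S \<noteq> {}"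
    using f T(2) by (auto simp: S_def \<phi>_def inv_into_into inj_on_inv_into)
  have own: "E s (\<phi> s)" if "s \<in> S" for s
    using that f E_sym by (metis S_def \<phi>_def f_inv_into_f inv_into_into)
  show ?thesis
  proof (cases "K = S")
    case True
    \<comment> \<open>Every \<open>v\<close> was picked as a neighbour of \<phi>\<open>v\<close>, so
      it sees that private colour in \<open>X\<close>; giving the colour to \<open>v\<close> itself
      is harmless, and injectivity keeps it off the rest of \<open>K\<close>.\<close>
    define g where "g = c \<circ> \<phi>"
    have inj: "inj_on g K" unfolding g_def True
      using S(2,3) inj_on_subset[OF inj_B] T(1) by (intro comp_inj_on) auto
    have "happy E (extend g) v" if v: "v \<in> K" for v
    proof (rule happy_if_seen[OF K v, of "g v"])
      have "\<phi> v \<in> B" "E v (\<phi> v)" using v own S(3) T(1) True by auto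
      then show "g v \<in> seen v" using private_seen by (simp add: g_def)
    qed (use inj v in \<open>auto dest: inj_onD\<close>)
    moreover have "g ` K \<subseteq> c ` T" using S(3) True by (auto simp: g_def)
    moreover have "\<exists>v\<in>K. E t v \<and> g v \<in> c ` T" if t: "t \<in> T" for t
      using S(4)[of t] t True S(3) unfolding g_def by fastforce
    ultimately have "serves K T g" using inj unfolding serves_def inj_on_def by blast
    then show ?thesis by blast
  next
    case False
    then obtain v0 where v0: "v0 \<in> K - S" using S(1) by blast
    show ?thesis
    proof (cases "\<phi> ` S = T \<and> seen v0 = c ` T")
      case False
      then show ?thesis using serves_if_dominating[OF K T(1) S v0] by blast
    next
      case True
      \<comment> \<open>In the only obstructing case \<open>v0\<close> sees all private colours of
        \<open>T\<close>, so it dominates \<open>T\<close> alone.\<close>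
      have dom: "E t v0" if "t \<in> T" for t
      proof -
        have "c t \<in> seen v0" using that True by blast
        then show ?thesis using private_seen E_sym that T(1) by blast
      qed
      obtain s where s: "s \<in> S" using S(5) by blast
      obtain t where t: "t \<in> T" using T(2) by blast
      show ?thesis
      proof (cases "T = {t}")
        \<comment> \<open>Now \<open>v0\<close> takes one private colour and \<open>s\<close> takes
          \<open>z\<close>; as \<open>T\<close> has a second element, the set of used elements is
          not \<open>T\<close>.\<close>
        case False
        then show ?thesis using v0 s t S(1) dom
          by (intro serves_if_dominating[OF K T(1), of "{v0}" "\<lambda>_. t" s]) auto
      next
        case single: True
        have "S = {s}" using s True single S(2)
          by (metis card_1_singletonE card_image is_singletonI is_singleton_altdef singletonD)
        then have "E t s" using S(4) t by blast
        \<comment> \<open>Both \<open>s\<close> and \<open>v0\<close> dominate \<open>T\<close>. The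
          vertex \<open>u\<close> takes \<open>z\<close>, and one of the two other than
          \<open>u\<close> takes the colour of \<open>t\<close>.\<close>
        obtain u where u: "u \<in> K" "seen u \<noteq> {c t}" using ne single by blast
        show ?thesis
        proof (cases "u = s")
          case True
          then show ?thesis using v0 s u t S(1) dom single
            by (intro serves_if_dominating[OF K T(1), of "{v0}" "\<lambda>_. t" u]) auto
        next
          case False
          then show ?thesis using s u t S(1) \<open>E t s\<close> single
            by (intro serves_if_dominating[OF K T(1), of "{s}" "\<lambda>_. t" u]) auto
        qed
      qed
    qed
  qed
qed

text \<open>For cliques to which no vertex of \<open>B\<close> is assigned. The colour
  \<open>p\<close> is confined to cliques seeing nothing in \<open>X\<close>; by
  \<open>not_D\<close> their \<open>X\<close>-neighbours all lie in \<open>D\<close>.\<close>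

definition free :: "'a set \<Rightarrow> ('a \<Rightarrow> 'c) \<Rightarrow> bool" where
  "free K g \<longleftrightarrow> (\<forall>v\<in>K. happy E (extend g) v) \<and> g ` K \<subseteq> {z, e, p} \<and>
     (p \<in> g ` K \<longrightarrow> (\<forall>v\<in>K. seen v = {}))"

lemma seen_empty_D: "\<lbrakk>v \<in> V - X; seen v = {}; x \<in> X; E v x\<rbrakk> \<Longrightarrow> x \<in> D"
  using not_D[of v x] unfolding seen_def by blast

text \<open>A vertex that sees a colour can be the one with \<open>z\<close>. If no vertex does, a
  one-vertex clique is covered by \<open>singleton\<close>, and in a larger one the vertex with
  \<open>z\<close> relies on a single \<open>p\<close>, which does not occur on
  \<open>D\<close>.\<close>

lemma free_exists:
  assumes K: "K \<in> cliques"
  shows "\<exists>g. free K g"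
proof (cases "\<exists>v0\<in>K. seen v0 \<noteq> {}")
  case True
  then obtain v0 q where v0: "v0 \<in> K" "q \<in> seen v0" by blast
  define g where "g u = (if u = v0 then z else e)" for u
  have "happy E (extend g) v" if v: "v \<in> K" for v
  proof (cases "v = v0")
    case True
    then show ?thesis using v0(2) e_not_seen
      by (intro happy_if_seen[OF K v, of q]) (auto simp: g_def)
  next
    case False
    then show ?thesis using v0(1) z_fresh distinct
      by (intro happy_if_clique[OF K v, of v0]) (auto simp: g_def split: if_splits)
  qed
  moreover have "g ` K \<subseteq> {z, e}" by (auto simp: g_def)
  ultimately have "free K g" using distinct unfolding free_def by blast
  then show ?thesis by blast
next
  case False
  then have empty: "seen v = {}" if "v \<in> K" for v using that by blast
  obtain w where w: "w \<in> K" using clique_ne[OF K] by blast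
  show ?thesis
  proof (cases "K = {w}")
    case True
    have nbr: "u \<in> X" if "E w u" for u using clique_adj_iff[OF K w, of u] that True by blast
    then obtain x where x: "x \<in> X" "E w x" "\<forall>x'\<in>X. E w x' \<longrightarrow> c x' = c x \<longrightarrow> x' = x"
      using singleton[of w] clique_outside[OF K w] by blast
    have "happy E (extend (\<lambda>_. z)) w"
      using x nbr unfolding happy_def extend_def by metis
    then show ?thesis using True distinct empty unfolding free_def by (intro exI[of _ "\<lambda>_. z"]) auto
  next
    case False
    then obtain w' where w': "w' \<in> K" "w' \<noteq> w" using w by blast
    define g where "g u = (if u = w then z else if u = w' then p else e)" for u
    have "happy E (extend g) v" if v: "v \<in> K" for v
    proof (cases "v = w")
      case True
      have "c x \<noteq> p" if "x \<in> X" "E v x" for x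
        using seen_empty_D[OF clique_outside[OF K v] empty[OF v] that] D_p by blast
      then show ?thesis using w' True distinct
        by (intro happy_if_clique[OF K v, of w']) (auto simp: g_def split: if_splits)
    next
      case False
      then show ?thesis using w z_fresh distinct
        by (intro happy_if_clique[OF K v, of w]) (auto simp: g_def split: if_splits)
    qed
    moreover have "g ` K \<subseteq> {z, e, p}" by (auto simp: g_def)
    ultimately have "free K g" using empty unfolding free_def by blast
    then show ?thesis by blast
  qed
qed

section \<open>Combining the cliques and providing for \<open>B\<close>\<close>

text \<open>In an exceptional clique for \<open>b\<close> all vertices are provided for by \<open>b\<close> itself.
  If all cliques adjacent to \<open>b\<close> are exceptional, then \<open>b\<close> is provided for by giving \<open>z\<close> to a
  single neighbour.\<close>

definition exceptional :: "'a set \<Rightarrow> 'a \<Rightarrow> bool" where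
  "exceptional K b \<longleftrightarrow> (\<forall>v\<in>K. seen v = {c b})"

definition bad :: "'a set" where
  "bad = {b \<in> B. \<forall>v. E b v \<longrightarrow> exceptional (clique_of v) b}"

lemma B_adj:
  assumes "b \<in> B" "E b v"
  shows "v \<in> V - X"
  using assms B_isolated adj_in by blast

text \<open>Seeing a private colour means being adjacent to its owner. Hence bad vertices have
  disjoint neighbourhoods and can choose their \<open>z\<close>-neighbours independently.\<close>

lemma exceptional_adj:
  assumes "exceptional K b" "b \<in> B" "b' \<in> B" "v \<in> K"
  shows "E b' v \<longleftrightarrow> b' = b"
proof -
  have "E b' v \<longleftrightarrow> c b' \<in> seen v" using private_seen[OF assms(3)] E_sym by blast
  also have "\<dots> \<longleftrightarrow> c b' = c b" using assms(1,4) by (auto simp: exceptional_def)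
  also have "\<dots> \<longleftrightarrow> b' = b" using inj_B assms(2,3) by (auto dest: inj_onD)
  finally show ?thesis .
qed

text \<open>Cliques are of three kinds: those that \<open>h\<close> assigns vertices of
  \<open>B\<close> to, those exceptional for a bad vertex, and the rest, coloured by
  \<open>gf\<close>. The last two conclusions protect the witnesses inside \<open>X\<close> and
  limit repeated colours for a later recolouring.\<close>

theorem colouring_exists:
  obtains F where
    "\<And>x. x \<in> X \<Longrightarrow> F x = c x"
    "\<And>v. v \<in> V - X \<Longrightarrow> F v \<in> {z, e, p} \<union> c ` B"
    "\<And>v. v \<in> V - X \<Longrightarrow> happy E F v"
    "\<And>b. b \<in> B \<Longrightarrow> happy E F b"
    "\<And>x v. \<lbrakk>x \<in> X - B - W; v \<in> V - X; E x v\<rbrakk> \<Longrightarrow> F v \<noteq> c (wit x)"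
    "\<And>u v. \<lbrakk>u \<in> V - X; v \<in> V - X; F u = F v; F u \<notin> {z, e}; seen u \<noteq> {}; seen v \<noteq> {}\<rbrakk> \<Longrightarrow> u = v"
proof -
  have "\<exists>v. E b v \<and> \<not> exceptional (clique_of v) b" if "b \<in> B - bad" for b
    using that by (auto simp: bad_def)
  then obtain h where h: "\<And>b. b \<in> B - bad \<Longrightarrow> E b (h b) \<and> \<not> exceptional (clique_of (h b)) b"
    by metis
  obtain w where w: "\<And>b. b \<in> B \<Longrightarrow> E b (w b)" using B_nbr by metis
  define T where "T K = {b \<in> B - bad. clique_of (h b) = K}" for K
  define excl where "excl K \<longleftrightarrow> (\<exists>b\<in>bad. exceptional K b)" for K
  have T_B: "T K \<subseteq> B" for K by (auto simp: T_def)
  have T_disjoint: "K = K'" if "b \<in> T K" "b \<in> T K'" for b K K'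
    using that by (auto simp: T_def)
  have "\<exists>g. serves K (T K) g" if K: "K \<in> cliques" and ne: "T K \<noteq> {}" for K
  proof (rule serves_exists[OF K T_B ne])
    show "\<exists>v\<in>K. E t v" if "t \<in> T K" for t
      using that h[of t] in_clique_of[of "h t"] by (auto simp: T_def)
    show "\<exists>v\<in>K. seen v \<noteq> {c x}" if "T K = {x}" for x
      using that h[of x] by (auto simp: T_def exceptional_def)
  qed
  then obtain gs where gs: "\<And>K. \<lbrakk>K \<in> cliques; T K \<noteq> {}\<rbrakk> \<Longrightarrow> serves K (T K) (gs K)" by metis
  obtain gf where gf: "\<And>K. K \<in> cliques \<Longrightarrow> free K (gf K)" using free_exists by metis
  define ge where "ge u = (if u \<in> w ` bad then z else e)" for u
  define G where "G K = (if T K \<noteq> {} then gs K else if excl K then ge else gf K)" for K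
  define F where "F = extend (\<lambda>v. G (clique_of v) v)"
  \<comment> \<open>The only neighbour of such a clique in \<open>B\<close> is a bad vertex, and bad
    vertices are never assigned.\<close>
  have excl_T: "T K = {}" if K: "excl K" for K
  proof (rule ccontr)
    assume "T K \<noteq> {}"
    then obtain t where t: "t \<in> T K" by blast
    obtain b where b: "b \<in> bad" "exceptional K b" using K by (auto simp: excl_def)
    have "h t \<in> K" "E t (h t)" "t \<in> B - bad" using t h[of t] by (auto simp: T_def)
    then show False using exceptional_adj[OF b(2), of t "h t"] b(1) by (auto simp: bad_def)
  qed
  have FX: "F x = c x" if "x \<in> X" for x using that by (simp add: F_def extend_def)
  have FK: "F v = G K v" if "K \<in> cliques" "v \<in> K" for v K
    using that clique_of_eq clique_outside by (simp add: F_def extend_def)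
  have happy_K: "happy E (extend (G K)) v" if K: "K \<in> cliques" and v: "v \<in> K" for v K
  proof -
    consider "T K \<noteq> {}" | "T K = {}" "excl K" | "T K = {}" "\<not> excl K" by blast
    then show ?thesis
    proof cases
      case 1
      then show ?thesis using gs[OF K] v by (auto simp: G_def serves_def)
    next
      case 2
      then obtain b where b: "b \<in> bad" "exceptional K b" by (auto simp: excl_def)
      have "b \<in> B" using b(1) by (simp add: bad_def)
      then have "c b \<noteq> z" "c b \<noteq> e" using B_subset z_fresh private_ne by auto
      then have "happy E (extend ge) v" using b(2) v
        by (intro happy_if_seen[OF K v, of "c b"]) (auto simp: exceptional_def ge_def)
      then show ?thesis using 2 by (simp add: G_def)
    next
      case 3
      then show ?thesis using gf[OF K] v by (auto simp: G_def free_def)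
    qed
  qed
  have colour: "F v \<in> {z, e} \<or> F v \<in> c ` T K \<or> F v = p \<and> (\<forall>u\<in>K. seen u = {})"
    if K: "K \<in> cliques" and v: "v \<in> K" for v K
  proof -
    consider "T K \<noteq> {}" | "T K = {}" "excl K" | "T K = {}" "\<not> excl K" by blast
    then show ?thesis
    proof cases
      case 1
      then show ?thesis using gs[OF K] v FK[OF K v] by (auto simp: G_def serves_def)
    next
      case 2
      then show ?thesis using FK[OF K v] by (simp add: G_def ge_def)
    next
      case 3
      then have "F v = gf K v" using FK[OF K v] by (simp add: G_def)
      then show ?thesis using gf[OF K] v unfolding free_def by auto
    qed
  qed
  have inj_T: "u = v"
    if u: "u \<in> V - X" "F u = c t" and v: "v \<in> V - X" "F v = c t"
      and t: "t \<in> T K" and K: "K \<in> cliques"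
      and ne: "seen u \<noteq> {}" "seen v \<noteq> {}" for u v t K
  proof -
    have tB: "t \<in> B" using t T_B by blast
    then have tz: "c t \<noteq> z" "c t \<noteq> e" using B_subset z_fresh private_ne by auto
    \<comment> \<open>Possibly \<open>c t = p\<close>, but \<open>p\<close> as a free colour occurs
      only in cliques that see nothing; so here the colour comes from the vertices assigned to the
      clique of \<open>x\<close>.\<close>
    have in_K: "x \<in> K" if x: "x \<in> V - X" "F x = c t" "seen x \<noteq> {}" for x
    proof -
      have "c t \<in> c ` T (clique_of x)"
        using colour[of "clique_of x" x] x tz by auto
      then have "t \<in> T (clique_of x)" using inj_B tB T_B by (metis inj_on_image_mem_iff)
      then show ?thesis using T_disjoint[OF _ t] in_clique_of by blast
    qed
    have "u \<in> K" "v \<in> K" using in_K u v ne by blast+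
    moreover have "T K \<noteq> {}" using t by blast
    moreover from this have "G K = gs K" by (simp add: G_def)
    ultimately show ?thesis using gs[OF K] FK[OF K] u(2) v(2) t unfolding serves_def by auto
  qed
  show thesis
  proof (rule that[of F])
    show "F x = c x" if "x \<in> X" for x using FX that .
    show "F v \<in> {z, e, p} \<union> c ` B" if "v \<in> V - X" for v
      using colour[of "clique_of v" v] that T_B by auto
    show "happy E F v" if "v \<in> V - X" for v
    proof (rule happy_cong[OF happy_K[of "clique_of v" v]])
      fix u assume "E v u"
      then have "u \<in> clique_of v \<or> u \<in> X"
        using clique_adj_iff[of "clique_of v" v u] that by auto
      then show "F u = extend (G (clique_of v)) u"
        using FX FK[of "clique_of v" u] that clique_outside[of "clique_of v" u]
        by (auto simp: extend_def)
    qed (use that in auto)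
    show "happy E F b" if b: "b \<in> B" for b
    proof (cases "b \<in> bad")
      case True
      have F_nbr: "F u = ge u" if "E b u" for u
      proof -
        have u: "u \<in> V - X" using B_adj b that by blast
        have "excl (clique_of u)" using True that by (auto simp: bad_def excl_def)
        then show ?thesis using FK[of "clique_of u" u] u excl_T by (simp add: G_def)
      qed
      \<comment> \<open>A neighbour of \<open>b\<close> coloured \<open>z\<close> was chosen by some
        bad \<open>b'\<close> adjacent to it, and \<open>exceptional_adj\<close> forces
        \<open>b' = b\<close>.\<close>
      have "u = w b" if u: "E b u" "F u = z" for u
      proof -
        obtain b' where b': "b' \<in> bad" "u = w b'"
          using F_nbr[OF u(1)] u(2) distinct by (auto simp: ge_def split: if_splits)
        then have "E b' u" "b' \<in> B" using w by (auto simp: bad_def)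
        moreover have "exceptional (clique_of u) b" using True u(1) by (simp add: bad_def)
        ultimately show ?thesis using exceptional_adj[of "clique_of u" b b' u] b b'(2) by simp
      qed
      moreover have "F (w b) = z" using F_nbr w[OF b] True by (simp add: ge_def)
      ultimately show ?thesis using w[OF b] unfolding happy_def by auto
    next
      case False
      define K where "K = clique_of (h b)"
      have "E b (h b)" using h b False by blast
      then have K: "K \<in> cliques" using B_adj[OF b] by (simp add: K_def)
      have bT: "b \<in> T K" using b False by (simp add: T_def K_def)
      then have "T K \<noteq> {}" by blast
      then obtain v where v: "v \<in> K" "E b v" "gs K v \<in> c ` T K"
        using gs[OF K] bT unfolding serves_def by blast
      have "F v = gs K v" using FK[OF K v(1)] \<open>T K \<noteq> {}\<close> by (simp add: G_def)
      then obtain t where t: "t \<in> T K" "F v = c t" using v(3) by auto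
      \<comment> \<open>Neighbours of \<open>b\<close> see its private colour, so
        \<open>inj_T\<close> applies to them even across cliques.\<close>
      have "seen u \<noteq> {}" if "E b u" for u using private_seen[OF b, of u] that E_sym by blast
      then have "u = v" if "E b u" "F u = F v" for u
        using inj_T[of u t v K] that t K v(2) B_adj[OF b] by auto
      then show ?thesis using v(2) unfolding happy_def by blast
    qed
    show "F v \<noteq> c (wit x)" if x: "x \<in> X - B - W" and v: "v \<in> V - X" and xv: "E x v" for x v
    proof
      assume Fv: "F v = c (wit x)"
      have wx: "wit x \<in> X" "wit x \<notin> B" "c (wit x) \<noteq> e" using wit[OF x] by auto
      then have "c (wit x) \<noteq> z" "c (wit x) \<notin> c ` B" using z_fresh private_unique by auto
      \<comment> \<open>Only \<open>p\<close> is left, on a clique that sees nothing. Then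
        \<open>x\<close> lies in \<open>D\<close>, contrary to \<open>wit_D\<close>.\<close>
      then have "F v = p" "seen v = {}"
        using colour[of "clique_of v" v] v Fv wx(3) T_B by auto
      then show False
        using seen_empty_D[OF v, of x] x xv E_sym wit_D[of x] Fv by auto
    qed
    show "u = v" if "u \<in> V - X" "v \<in> V - X" "F u = F v" "F u \<notin> {z, e}" "seen u \<noteq> {}" "seen v \<noteq> {}"
      for u v
    proof -
      have "F u \<in> c ` T (clique_of u)"
        using colour[of "clique_of u" u] that by auto
      then show ?thesis using inj_T[of u _ v "clique_of u"] that by auto
    qed
  qed
qed

lemma happy_wit:
  assumes F: "\<And>x. x \<in> X \<Longrightarrow> F x = c x"
    and x: "x \<in> X - B - W" "\<And>v. \<lbrakk>v \<in> V - X; E x v\<rbrakk> \<Longrightarrow> F v \<noteq> c (wit x)"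
  shows "happy E F x"
proof -
  have w: "wit x \<in> X" "E x (wit x)" using wit[OF x(1)] by auto
  have "u = wit x" if u: "E x u" "F u = F (wit x)" for u
  proof (cases "u \<in> X")
    case True
    then show ?thesis using wit_unique[OF x(1) True u(1)] u(2) F w(1) by simp
  next
    case False
    then show ?thesis using x(2)[of u] u F w(1) adj_in by auto
  qed
  then show ?thesis using w(2) unfolding happy_def by blast
qed

end

section \<open>Colouring \<open>X\<close> with one colour to spare\<close>

context cluster_modulator
begin

text \<open>Each element of \<open>X\<close> is its own colour, and that of \<open>y\<close> doubles
  as \<open>e\<close>. Only vertices with \<open>y\<close> as sole \<open>X\<close>-neighbour may
  then lack a witness. The last two conclusions prepare the recolouring in
  \<open>cherry_colouring\<close>.\<close>

lemma injective_colouring: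
  assumes no_isolated: "\<And>v. v \<in> V \<Longrightarrow> \<exists>u. E v u"
    and y: "y \<in> X" "y' \<in> X" "E y y'" and q: "q \<in> X - {y, y'}"
  obtains F where
    "\<And>x. x \<in> X \<Longrightarrow> F x = Some x"
    "\<And>v. v \<in> V \<Longrightarrow> F v \<in> insert None (Some ` X)"
    "\<And>v. \<lbrakk>v \<in> V; v \<notin> X \<or> {u \<in> X. E v u} \<noteq> {y}\<rbrakk> \<Longrightarrow> happy E F v"
    "\<And>v. \<lbrakk>v \<in> V - X; E y v\<rbrakk> \<Longrightarrow> F v \<noteq> Some y'"
    "\<And>u v x. \<lbrakk>x \<in> X - {y}; E x u; E x v; u \<in> V - X; v \<in> V - X; F u = F v;
       F u \<notin> {None, Some y}\<rbrakk> \<Longrightarrow> u = v"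
proof -
  define B where "B = {x \<in> X. \<forall>u\<in>X. \<not> E x u}"
  define W where "W = {x \<in> X. {u \<in> X. E x u} = {y}}"
  define wit where "wit x = (if x = y then y' else SOME u. u \<in> X \<and> E x u \<and> u \<noteq> y)" for x
  have wit: "wit x \<in> X \<and> E x (wit x) \<and> wit x \<noteq> y" if "x \<in> X - B - W" for x
  proof (cases "x = y")
    case True
    then show ?thesis using y E_irrefl by (auto simp: wit_def)
  next
    case False
    have "\<exists>u. u \<in> X \<and> E x u \<and> u \<noteq> y" using that unfolding B_def W_def by blast
    from someI_ex[OF this] show ?thesis using False by (simp add: wit_def)
  qed
  have B: "b \<in> X \<and> b \<noteq> y" "\<not> E b x" if "b \<in> B" "x \<in> X" for b x
    using that y by (auto simp: B_def)
  \<comment> \<open>\<open>D = {y}\<close> suffices since any other \<open>X\<close>-neighbour is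
    seen uniquely. As \<open>q\<close> differs from \<open>y\<close> and from its witness
    \<open>y'\<close>, it can supply \<open>p\<close>.\<close>
  interpret modulator_colouring V X E B "{y}" W Some None "Some y" "Some q" wit
  proof
    show "B \<subseteq> X" by (auto simp: B_def)
    show "\<exists>v. E b v" if "b \<in> B" for b using no_isolated that X_subset by (auto simp: B_def)
    show "wit x \<in> X - B \<and> E x (wit x) \<and> Some (wit x) \<noteq> Some y" if "x \<in> X - B - W" for x
      using wit[OF that] that B(2)[of "wit x" x] E_sym[of x "wit x"] by auto
    show "\<exists>x\<in>X. E v x \<and> Some x \<noteq> Some y \<and> (\<forall>x'\<in>X. E v x' \<longrightarrow> Some x' = Some x \<longrightarrow> x' = x)"
      if "v \<in> V - X" "x \<in> X - {y}" "E v x" for v x using that by auto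
    show "\<exists>x\<in>X. E v x \<and> (\<forall>x'\<in>X. E v x' \<longrightarrow> Some x' = Some x \<longrightarrow> x' = x)"
      if "v \<in> V - X" "\<And>u. E v u \<Longrightarrow> u \<in> X" for v using that no_isolated[of v] by auto
    show "Some (wit x) \<noteq> Some q" if "x \<in> (X - B - W) \<inter> {y}" for x
      using that q by (auto simp: wit_def)
  qed (use q B y in auto)
  obtain F where F: "\<And>x. x \<in> X \<Longrightarrow> F x = Some x"
    "\<And>v. v \<in> V - X \<Longrightarrow> F v \<in> {None, Some y, Some q} \<union> Some ` B"
    "\<And>v. v \<in> V - X \<Longrightarrow> happy E F v"
    "\<And>b. b \<in> B \<Longrightarrow> happy E F b"
    "\<And>x v. \<lbrakk>x \<in> X - B - W; v \<in> V - X; E x v\<rbrakk> \<Longrightarrow> F v \<noteq> Some (wit x)"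
    "\<And>u v. \<lbrakk>u \<in> V - X; v \<in> V - X; F u = F v; F u \<notin> {None, Some y}; seen u \<noteq> {}; seen v \<noteq> {}\<rbrakk>
      \<Longrightarrow> u = v"
    by (rule colouring_exists) (rule that)
  show thesis
  proof (rule that[of F])
    show "F x = Some x" if "x \<in> X" for x using F(1) that .
    show "F v \<in> insert None (Some ` X)" if "v \<in> V" for v
      using F(1)[of v] F(2)[of v] that y(1) q B_subset by (cases "v \<in> X") auto
    show "happy E F v" if v: "v \<in> V" "v \<notin> X \<or> {u \<in> X. E v u} \<noteq> {y}" for v
    proof -
      consider "v \<in> V - X" | "v \<in> B" | "v \<in> X - B - W" using v by (auto simp: W_def)
      then show ?thesis using F(3,4) happy_wit[OF F(1) _ F(5)] by cases auto
    qed
    show "F v \<noteq> Some y'" if "v \<in> V - X" "E y v" for v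
    proof -
      have "y \<in> X - B - W" using y E_irrefl by (auto simp: B_def W_def)
      then show ?thesis using F(5)[of y v] that by (simp add: wit_def)
    qed
    show "u = v" if x: "x \<in> X - {y}" "E x u" "E x v"
      and "u \<in> V - X" "v \<in> V - X" "F u = F v" "F u \<notin> {None, Some y}" for u v x
    proof -
      have "Some x \<in> seen u" "Some x \<in> seen v" using x E_sym by (auto simp: seen_def)
      then show ?thesis using F(6)[of u v] that by blast
    qed
  qed
qed

text \<open>Here the isolated edge \<open>{x1, x2}\<close> of \<open>X\<close> is monochromatic, which saves a colour that
  does not occur in \<open>X\<close>. A vertex adjacent to both ends gains nothing from them.\<close>

lemma merged_colouring:
  assumes no_isolated: "\<And>v. v \<in> V \<Longrightarrow> \<exists>u. E v u"
    and x1: "x1 \<in> X" "{u \<in> X. E x1 u} = {x2}" and x2: "{u \<in> X. E x2 u} = {x1}"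
    and q: "q \<in> X - {x1, x2}"
    and no_cherry: "\<And>v. v \<in> V - X \<Longrightarrow> {u. E v u} \<noteq> {x1, x2}"
  obtains F where "\<And>v. v \<in> V \<Longrightarrow> F v \<in> insert None (Some ` X)"
    "\<And>v. v \<in> V \<Longrightarrow> happy E F v"
proof -
  define B where "B = {x \<in> X. \<forall>u\<in>X. \<not> E x u}"
  define c where "c x = Some (if x = x1 then x2 else x)" for x
  define wit where "wit x = (SOME u. u \<in> X \<and> E x u)" for x
  have adj1: "E x1 u \<longleftrightarrow> u = x2" if "u \<in> X" for u using x1(2) that by blast
  have adj2: "E x2 u \<longleftrightarrow> u = x1" if "u \<in> X" for u using x2 that by blast
  have x2X: "x2 \<in> X" and ne: "x1 \<noteq> x2" using x1 E_irrefl by blast+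
  have wit: "wit x \<in> X \<and> E x (wit x)" if "x \<in> X - B" for x
  proof -
    have "\<exists>u. u \<in> X \<and> E x u" using that unfolding B_def by blast
    from someI_ex[OF this] show ?thesis by (simp add: wit_def)
  qed
  have wit1: "wit x1 = x2" if "x1 \<in> X - B" using wit[OF that] adj1 by blast
  have wit2: "wit x2 = x1" if "x2 \<in> X - B" using wit[OF that] adj2 by blast
  have B_ne: "b \<noteq> x1" "b \<noteq> x2" if "b \<in> B" for b
    using that x1(1) x2X adj1 adj2 by (auto simp: B_def)
  have c_eq: "x = x' \<or> {x, x'} = {x1, x2}" if "c x = c x'" for x x'
    using that by (auto simp: c_def split: if_splits)
  have c_x1: "c x \<noteq> Some x1" for x using ne by (auto simp: c_def)
  \<comment> \<open>Both ends have colour \<open>Some x2\<close>, so \<open>Some x1\<close> is free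
    to be \<open>e\<close>.\<close>
  interpret modulator_colouring V X E B "{x1, x2}" "{}" c None "Some x1" "Some q" wit
  proof
    show "B \<subseteq> X" by (auto simp: B_def)
    show "x = b" if "b \<in> B" "x \<in> X" "c x = c b" for b x
      using c_eq[OF that(3)] B_ne[OF that(1)] by (auto simp: doubleton_eq_iff)
    show "\<exists>v. E b v" if "b \<in> B" for b using no_isolated that X_subset by (auto simp: B_def)
    show "wit x \<in> X - B \<and> E x (wit x) \<and> c (wit x) \<noteq> Some x1" if "x \<in> X - B - {}" for x
      using wit[of x] that E_sym[of x "wit x"] c_x1 by (auto simp: B_def)
    show "x' = wit x" if "x \<in> X - B - {}" "x' \<in> X" "E x x'" "c x' = c (wit x)" for x x'
    proof (rule ccontr)
      assume "x' \<noteq> wit x"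
      then have "{x', wit x} = {x1, x2}" using c_eq that(4) by blast
      \<comment> \<open>A repeated witness colour needs a vertex of \<open>X\<close> adjacent to
        both ends, but each end has only the other as \<open>X\<close>-neighbour.\<close>
      then have "E x x1" "E x x2" using that(1,3) wit[of x] by (auto simp: doubleton_eq_iff)
      then have "E x1 x" "E x2 x" using E_sym by blast+
      then show False using adj1 adj2 that(1) ne E_irrefl by blast
    qed
    show "\<exists>x\<in>X. E v x \<and> c x \<noteq> Some x1 \<and> (\<forall>x'\<in>X. E v x' \<longrightarrow> c x' = c x \<longrightarrow> x' = x)"
      if "v \<in> V - X" "x \<in> X - {x1, x2}" "E v x" for v x
    proof (intro bexI conjI ballI impI)
      show "x' = x" if "c x' = c x" for x'
        using c_eq[OF that] \<open>x \<in> X - {x1, x2}\<close> by (auto simp: doubleton_eq_iff)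
    qed (use that c_x1 in auto)
    show "\<exists>x\<in>X. E v x \<and> (\<forall>x'\<in>X. E v x' \<longrightarrow> c x' = c x \<longrightarrow> x' = x)"
      if v: "v \<in> V - X" "\<And>u. E v u \<Longrightarrow> u \<in> X" for v
    proof -
      obtain x where x: "E v x" "x \<in> X" using no_isolated[of v] v by auto
      have "\<exists>x. E v x \<and> (x \<notin> {x1, x2} \<or> \<not> (E v x1 \<and> E v x2))"
        using x no_cherry[OF v(1)] by blast
      then obtain x where x: "E v x" "x \<notin> {x1, x2} \<or> \<not> (E v x1 \<and> E v x2)" by blast
      have "x' = x" if "E v x'" "c x' = c x" for x'
        using c_eq[OF that(2)] x that(1) by (auto simp: doubleton_eq_iff)
      then show ?thesis using x(1) v(2) by blast
    qed
    show "c (wit x) \<noteq> Some q" if "x \<in> (X - B - {}) \<inter> {x1, x2}" for x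
      using that q wit1 wit2 by (auto simp: c_def)
    show "c x \<noteq> Some q" if "x \<in> {x1, x2}" for x using that q by (auto simp: c_def)
    show "c b \<noteq> Some x1" for b by (rule c_x1)
    show "\<not> E b x" if "b \<in> B" "x \<in> X" for b x using that by (auto simp: B_def)
    show "c x \<noteq> None" for x by (simp add: c_def)
  qed (use q in auto)
  obtain F where F: "\<And>x. x \<in> X \<Longrightarrow> F x = c x"
    "\<And>v. v \<in> V - X \<Longrightarrow> F v \<in> {None, Some x1, Some q} \<union> c ` B"
    "\<And>v. v \<in> V - X \<Longrightarrow> happy E F v"
    "\<And>b. b \<in> B \<Longrightarrow> happy E F b"
    "\<And>x v. \<lbrakk>x \<in> X - B - {}; v \<in> V - X; E x v\<rbrakk> \<Longrightarrow> F v \<noteq> c (wit x)"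
    by (rule colouring_exists) (rule that)
  show thesis
  proof (rule that[of F])
    have "c x \<in> Some ` X" if "x \<in> X" for x using that x2X by (auto simp: c_def)
    then show "F v \<in> insert None (Some ` X)" if "v \<in> V" for v
      using F(1)[of v] F(2)[of v] that x1(1) q B_subset by (cases "v \<in> X") auto
    show "happy E F v" if v: "v \<in> V" for v
    proof -
      consider "v \<in> V - X" | "v \<in> B" | "v \<in> X - B - {}" using v by auto
      then show ?thesis using F(3,4) happy_wit[OF F(1) _ F(5)] by cases auto
    qed
  qed
qed

text \<open>Taking \<open>x1\<close> for \<open>y\<close> leaves only \<open>x2\<close> in doubt.
  Recolouring \<open>v\<close> can affect only its two neighbours \<open>x1\<close> and
  \<open>x2\<close>.\<close>

lemma cherry_colouring:
  assumes no_isolated: "\<And>v. v \<in> V \<Longrightarrow> \<exists>u. E v u"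
    and x1: "x1 \<in> X" "{u \<in> X. E x1 u} = {x2}" and x2: "{u \<in> X. E x2 u} = {x1}"
    and q: "q \<in> X - {x1, x2}"
    and v: "v \<in> V - X" "{u. E v u} = {x1, x2}"
  obtains F where "\<And>v. v \<in> V \<Longrightarrow> F v \<in> insert None (Some ` X)"
    "\<And>v. v \<in> V \<Longrightarrow> happy E F v"
proof -
  have adj: "E x1 x2" "E x2 x1" "x2 \<in> X" using x1 x2 by blast+
  have vx: "E x2 v" using v(2) E_sym[of v x2] by blast
  have only_x2: "{u \<in> X. E x u} \<noteq> {x1}" if "x \<in> X" "x \<noteq> x2" for x
    using that x1(2) E_sym[of x x1] by blast
  obtain F where F: "\<And>x. x \<in> X \<Longrightarrow> F x = Some x"
    "\<And>v. v \<in> V \<Longrightarrow> F v \<in> insert None (Some ` X)"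
    "\<And>v. \<lbrakk>v \<in> V; v \<notin> X \<or> {u \<in> X. E v u} \<noteq> {x1}\<rbrakk> \<Longrightarrow> happy E F v"
    "\<And>v. \<lbrakk>v \<in> V - X; E x1 v\<rbrakk> \<Longrightarrow> F v \<noteq> Some x2"
    "\<And>u v x. \<lbrakk>x \<in> X - {x1}; E x u; E x v; u \<in> V - X; v \<in> V - X; F u = F v;
       F u \<notin> {None, Some x1}\<rbrakk> \<Longrightarrow> u = v"
    by (rule injective_colouring[OF _ x1(1) adj(3,1) q], erule no_isolated) (rule that)
  have other: "happy E F u" if "u \<in> V" "u \<noteq> x2" for u
    using F(3) only_x2 that by blast
  have nbr_x2: "u = x1 \<or> u \<in> V - X" if "E x2 u" for u
    using that x2 adj_in by blast
  show thesis
  \<comment> \<open>If some neighbour of \<open>x2\<close> outside \<open>X\<close> has colour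
    \<open>Some q\<close>, it is the only one; otherwise \<open>v\<close> becomes the only
    one.\<close>
  proof (cases "\<exists>u\<in>V - X. E x2 u \<and> F u = Some q")
    case True
    then obtain u where u: "u \<in> V - X" "E x2 u" "F u = Some q" by blast
    have "u' = u" if u': "E x2 u'" "F u' = F u" for u'
    proof -
      have "F x1 \<noteq> F u" using F(1)[OF x1(1)] u(3) q by auto
      then have "u' \<in> V - X" using nbr_x2[OF u'(1)] u'(2) by blast
      moreover have "x2 \<in> X - {x1}" using adj E_irrefl by blast
      moreover have "F u' \<notin> {None, Some x1}" using u'(2) u(3) q by simp
      ultimately show ?thesis using F(5)[of x2 u' u] u' u(1,2) by simp
    qed
    then have "happy E F x2" using u(2) unfolding happy_def by blast
    then have "happy E F u" if "u \<in> V" for u using other that by blast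
    then show ?thesis using that[of F] F(2) by blast
  next
    case False
    define F' where "F' = F(v := Some q)"
    have "happy E F' u" if u: "u \<in> V" for u
    proof -
      consider "u = x1" | "u = x2" | "\<not> E u v" "u \<noteq> x2"
        using v(2) E_sym[of u v] by blast
      then show ?thesis
      proof cases
        case 1
        \<comment> \<open>The witness \<open>x2\<close> of \<open>x1\<close> survives: neighbours of
          \<open>x1\<close> outside \<open>X\<close> avoided its colour, and the new colour of
          \<open>v\<close> differs from it.\<close>
        have "u' = x2" if "E x1 u'" "F' u' = F' x2" for u'
        proof (cases "u' \<in> X")
          case True
          then show ?thesis using x1(2) that(1) by blast
        next
          case False
          have "x2 \<noteq> v" using adj(3) v(1) by blast
          then have "F' u' = Some x2" using that(2) F(1)[OF adj(3)] by (simp add: F'_def)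
          then show ?thesis using F(4)[of u'] False that(1) q adj_in
            by (auto simp: F'_def split: if_splits)
        qed
        then show ?thesis using adj(1) 1 unfolding happy_def by blast
      next
        case 2
        have "u' = v" if "E x2 u'" "F' u' = F' v" for u'
          using nbr_x2[OF that(1)] False that q F(1)[OF x1(1)] by (auto simp: F'_def split: if_splits)
        then show ?thesis using vx 2 unfolding happy_def by blast
      next
        case 3
        show ?thesis
          by (rule happy_cong[OF other[OF u]]) (use 3 in \<open>auto simp: F'_def\<close>)
      qed
    qed
    moreover have "F' u \<in> insert None (Some ` X)" if "u \<in> V" for u
      using F(2)[OF that] q by (auto simp: F'_def)
    ultimately show ?thesis using that by blast
  qed
qed

theorem happy_colouring_exists:
  assumes no_isolated: "\<And>v. v \<in> V \<Longrightarrow> \<exists>u. E v u"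
    and X: "finite X" "card X \<ge> 3" and edge: "x \<in> X" "x' \<in> X" "E x x'"
  obtains F where "\<And>v. v \<in> V \<Longrightarrow> F v \<in> insert None (Some ` X)"
    "\<And>v. v \<in> V \<Longrightarrow> happy E F v"
proof -
  have third: "\<exists>q. q \<in> X - {u, v}" for u v
  proof -
    have "\<not> X \<subseteq> {u, v}"
      using X card_mono[of "{u, v}" X] card_insert_le_m1[of 2 "{v}" u] by auto
    then show ?thesis by blast
  qed
  show thesis
  proof (cases "\<exists>y\<in>X. (\<exists>y'\<in>X. E y y') \<and> (\<forall>w\<in>X. {u \<in> X. E w u} \<noteq> {y})")
    case True
    then obtain y y' q where "y \<in> X" "y' \<in> X" "E y y'" "\<forall>w\<in>X. {u \<in> X. E w u} \<noteq> {y}"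
      "q \<in> X - {y, y'}" using third by metis
    then show ?thesis using injective_colouring[OF no_isolated, of y y' q] that by metis
  next
    case False
    then have leaf: "\<exists>w\<in>X. {u \<in> X. E w u} = {y}" if "y \<in> X" "y' \<in> X" "E y y'" for y y'
      using that by blast
    \<comment> \<open>Stepping from \<open>x\<close> to \<open>x1\<close> and on to
      \<open>x2\<close> must lead back to \<open>x\<close>, the sole \<open>X\<close>-neighbour of
      \<open>x1\<close>. So \<open>x1\<close> and \<open>x2\<close> form an isolated edge of
      \<open>X\<close>.\<close>
    obtain x1 where x1: "x1 \<in> X" "{u \<in> X. E x1 u} = {x}" using leaf edge by blast
    then have "E x1 x" by blast
    then obtain x2 where x2: "x2 \<in> X" "{u \<in> X. E x2 u} = {x1}" using leaf x1(1) edge(1) by blast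
    then have "E x1 x2" using E_sym by blast
    then have "x2 \<in> {u \<in> X. E x1 u}" using x2(1) by blast
    then have x12: "{u \<in> X. E x1 u} = {x2}" using x1(2) by simp
    obtain q where q: "q \<in> X - {x1, x2}" using third by blast
    show ?thesis
    proof (cases "\<exists>v\<in>V - X. {u. E v u} = {x1, x2}")
      case True
      then show ?thesis
        using cherry_colouring[OF no_isolated x1(1) x12 x2(2) q] that by metis
    next
      case False
      then show ?thesis
        using merged_colouring[OF no_isolated x1(1) x12 x2(2) q] that by metis
    qed
  qed
qed

end

section \<open>From unique colours to the CFON chromatic number\<close>

lemma chi_ON_le_if_happy:
  assumes fin: "finite A" "card A = k"
    and F: "\<And>v. v \<in> verts G \<Longrightarrow> F v \<in> A"
    and happy: "\<And>v. v \<in> verts G \<Longrightarrow> happy (dominates G) F v"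
    and wf: "\<And>u v. u \<rightarrow>\<^bsub>G\<^esub> v \<Longrightarrow> v \<in> verts G"
  shows "chi_ON G \<le> enat k"
proof -
  obtain f where f: "bij_betw f A {1..k}"
    using fin ex_bij_betw_nat_finite_1 bij_betw_inv by metis
  define C where "C = f \<circ> F"
  have in_k: "C v \<in> {1..k}" if "v \<in> verts G" for v
    using f F[OF that] by (auto simp: C_def bij_betw_def)
  have "\<exists>i\<in>{1..k}. card (open_nbhd G v \<inter> C -` {i}) = 1" if v: "v \<in> verts G" for v
  proof -
    obtain u where u: "v \<rightarrow>\<^bsub>G\<^esub> u" "\<And>u'. \<lbrakk>v \<rightarrow>\<^bsub>G\<^esub> u'; F u' = F u\<rbrakk> \<Longrightarrow> u' = u"
      using happy[OF v] unfolding happy_def by blast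
    have "u' = u" if "v \<rightarrow>\<^bsub>G\<^esub> u'" "C u' = C u" for u'
      using that u f F wf unfolding C_def bij_betw_def by (metis comp_apply inj_onD)
    then have "open_nbhd G v \<inter> C -` {C u} = {u}"
      using u(1) wf by (auto simp: open_nbhd_def)
    then show ?thesis using in_k[OF wf[OF u(1)]] by (intro bexI[of _ "C u"]) auto
  qed
  then have "cfon_coloring G k C" using in_k by (auto simp: cfon_coloring_def)
  then show ?thesis unfolding chi_ON_def by (intro INF_lower) auto
qed

lemma (in graph) connected_no_isolated:
  assumes "connected G" "card (verts G) \<ge> 2" "v \<in> verts G"
  shows "\<exists>u. v \<rightarrow> u"
proof -
  obtain w where w: "w \<in> verts G" "w \<noteq> v"
    using assms(2,3) by (metis card_le_Suc0_iff_eq finite_verts not_less_eq_eq numeral_2_eq_2)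
  have "v \<rightarrow>\<^sup>*\<^bsub>with_proj (mk_symmetric G)\<^esub> w"
    using assms(1,3) w(1) by (auto simp: connected_def strongly_connected_def)
  \<comment> \<open>Connectedness is stated for the symmetric closure, which has the same
    reachability here; the walk to \<open>w\<close> then has a first arc.\<close>
  then have "v \<rightarrow>\<^sup>* w" using reachable_mk_symmetric_eq[OF sym_arcs] by simp
  then show ?thesis using w(2) by (metis converse_reachable_cases)
qed

theorem theorem9:
  fixes G :: "('a, 'b) pre_digraph" and X :: "'a set" and d :: nat
  assumes "graph G"
    and "connected G"
    and "card (verts G) \<ge> 2"
    and "X \<subseteq> verts G"
    and "card X = d"
    and "d \<ge> 3"
    and "disjoint_union_of_cliques (G \<restriction> (verts G - X))"
    and "\<not> independent_set G X"
  shows "chi_ON G \<le> enat (d + 1)"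
proof -
  interpret graph G by fact
  obtain P where P: "partition_on (verts G - X) P"
    and adj: "\<And>u v. \<lbrakk>u \<in> verts G - X; v \<in> verts G - X\<rbrakk> \<Longrightarrow>
      u \<rightarrow>\<^bsub>G \<restriction> (verts G - X)\<^esub> v \<longleftrightarrow> u \<noteq> v \<and> (\<exists>K\<in>P. u \<in> K \<and> v \<in> K)"
    using assms(7) unfolding disjoint_union_of_cliques_def by auto
  have adj: "u \<rightarrow>\<^bsub>G\<^esub> v \<longleftrightarrow> u \<noteq> v \<and> (\<exists>K\<in>P. u \<in> K \<and> v \<in> K)"
    if "u \<in> verts G - X" "v \<in> verts G - X" for u v
  proof -
    have "u \<rightarrow>\<^bsub>G\<^esub> v \<longleftrightarrow> u \<rightarrow>\<^bsub>G \<restriction> (verts G - X)\<^esub> v"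
      using that by (fastforce simp: arcs_ends_conv)
    then show ?thesis using adj that by blast
  qed
  interpret cluster_modulator "verts G" X "dominates G"
  proof
    show "X \<subseteq> verts G" by fact
    show "u \<rightarrow>\<^bsub>G\<^esub> v \<Longrightarrow> v \<rightarrow>\<^bsub>G\<^esub> u" for u v using arcs_ends_symmetric sym_arcs by metis
    show "\<not> v \<rightarrow>\<^bsub>G\<^esub> v" for v using adj_not_same by blast
    show "u \<rightarrow>\<^bsub>G\<^esub> v \<Longrightarrow> v \<in> verts G" for u v using adj_in_verts by blast
    show "u \<rightarrow>\<^bsub>G\<^esub> w"
      if uvw: "u \<in> verts G - X" "v \<in> verts G - X" "w \<in> verts G - X"
        and e: "u \<rightarrow>\<^bsub>G\<^esub> v" "v \<rightarrow>\<^bsub>G\<^esub> w" "u \<noteq> w"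
      for u v w
    proof -
      obtain K L where KL: "K \<in> P" "u \<in> K" "v \<in> K" "L \<in> P" "v \<in> L" "w \<in> L"
        using e adj[of u v] adj[of v w] uvw by blast
      then have "K = L"
        using disjointD[OF partition_onD2[OF P], of K L] by blast
      then show ?thesis using adj[of u w] uvw e(3) KL by blast
    qed
  qed
  have X: "finite X" "card X \<ge> 3" using assms(4-6) finite_subset[OF _ finite_verts] by auto
  obtain x x' where "x \<in> X" "x' \<in> X" "x \<rightarrow>\<^bsub>G\<^esub> x'"
    using assms(4,8) unfolding independent_set_def by blast
  then obtain F where "\<And>v. v \<in> verts G \<Longrightarrow> F v \<in> insert None (Some ` X)"
    "\<And>v. v \<in> verts G \<Longrightarrow> happy (dominates G) F v"
    using happy_colouring_exists[OF connected_no_isolated[OF assms(2,3)] X] by metis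
  moreover have "card (insert None (Some ` X)) = d + 1"
    using X(1) assms(5) by (simp add: card_image)
  ultimately show ?thesis using X(1) adj_in_verts
    by (intro chi_ON_le_if_happy[of "insert None (Some ` X)" _ G F]) auto
qed

end
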